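(* $\operatorname{pf}(K_{2n}) = \Omega(n \log_2 n)$; that is, there exist a constant $c>0$ and an integer $n_0$ such that $\operatorname{pf}(K_{2n}) \geq c\, n\log_2 n$ for all $n\ge n_0$, where $K_{2n}$ is the complete graph on $2n$ vertices.
   Context: Given an orientation $D$ of a finite simple graph $G$ with vertices enumerated $1,\dots,2m$ and a perfect matching $M$ of $G$, $\operatorname{sign}_D(M)\in\{1,-1\}$ is the sign of the permutation $\begin{pmatrix}1&2&\cdots&2m-1&2m\\ u_1&v_1&\cdots&u_m&v_m\end{pmatrix}$, where the edges of $M$ are $u_iv_i$, oriented in $D$ from $u_i$ to $v_i$ (independent of the order in which the edges are listed). For a positive integer $k$, a $k$-orientation of $G$ is a vector $\mathbf{D}=(D_1,\dots,D_k)$ of orientations of $G$; for a perfect matching $M$, $\mathbf{sign}_{\mathbf{D}}(M) := (\operatorname{sign}_{D_1}(M),\dots,\operatorname{sign}_{D_k}(M))$, and the signature matrix $\mathbf{sign}_{\mathbf{D}}$ has these vectors as rows, one row for each perfect matching $M$ of $G$. $\mathbf{D}$ is pfaffian if $\mathbf{sign}_{\mathbf{D}}\,\mathbf{x}=\mathbf{1}$ has a solution $\mathbf{x}\in\mathbb{R}^k$. $G$ is $k$-pfaffian if it admits a pfaffian $k$-orientation (independent of the enumeration of the vertices). The pfaffian number $\operatorname{pf}(G)$ is the smallest positive integer $k$ such that $G$ is $k$-pfaffian (it always exists). *)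

theory Defs
  imports Complex_Main "HOL-Library.Disjoint_Sets" "HOL-Library.Ramsey" "HOL-Combinatorics.Permutations"
begin

text \<open>
  A finite simple graph with vertices enumerated \<open>1, \<dots>, 2m\<close> is given by \<open>m\<close> and its set \<open>E\<close> of
  edges, which are two-element subsets of \<open>{1..2*m}\<close>.
\<close>

definition perfect_matching :: "nat \<Rightarrow> nat set set \<Rightarrow> nat set set \<Rightarrow> bool" where
  "perfect_matching m E M \<longleftrightarrow> M \<subseteq> E \<and> (\<forall>v\<in>{1..2*m}. \<exists>!e. e \<in> M \<and> v \<in> e)"

text \<open>An orientation is a set of arcs \<open>(u, v)\<close> (from \<open>u\<close> to \<open>v\<close>), exactly one for each edge.\<close>

definition orientation :: "nat set set \<Rightarrow> (nat \<times> nat) set \<Rightarrow> bool" where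
  "orientation E D \<longleftrightarrow> bij_betw (\<lambda>(u, v). {u, v}) D E"

text \<open>
  \<open>p\<close> is the permutation sending \<open>1, 2, \<dots>, 2m-1, 2m\<close> to \<open>u\<^sub>1, v\<^sub>1, \<dots>, u\<^sub>m, v\<^sub>m\<close>, for some
  listing \<open>(u\<^sub>1, v\<^sub>1), \<dots>, (u\<^sub>m, v\<^sub>m)\<close> of the edges of \<open>M\<close> as oriented in \<open>D\<close>.
\<close>

definition lists_matching ::
    "nat \<Rightarrow> (nat \<times> nat) set \<Rightarrow> nat set set \<Rightarrow> (nat \<Rightarrow> nat) \<Rightarrow> bool" where
  "lists_matching m D M p \<longleftrightarrow>
     p permutes {1..2*m} \<and>
     (\<lambda>i. (p (2*i - 1), p (2*i))) ` {1..m} = {(u, v) \<in> D. {u, v} \<in> M}"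

text \<open>
  By \<open>lists_matching_exists\<close> and \<open>lists_matching_sign_unique\<close> below, for a perfect matching the
  choice of \<open>p\<close> exists and does not matter.
\<close>

definition matching_sign :: "nat \<Rightarrow> (nat \<times> nat) set \<Rightarrow> nat set set \<Rightarrow> int" where
  "matching_sign m D M = sign (SOME p. lists_matching m D M p)"

text \<open>A \<open>k\<close>-orientation is a family \<open>Ds 1, \<dots>, Ds k\<close>; values of \<open>Ds\<close> at other indices are ignored.\<close>

definition k_orientation ::
    "nat set set \<Rightarrow> nat \<Rightarrow> (nat \<Rightarrow> (nat \<times> nat) set) \<Rightarrow> bool" where
  "k_orientation E k Ds \<longleftrightarrow> (\<forall>j\<in>{1..k}. orientation E (Ds j))"

text \<open>The signature matrix: rows are indexed by perfect matchings \<open>M\<close>, columns by \<open>j \<in> {1..k}\<close>.\<close>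

definition signature_matrix ::
    "nat \<Rightarrow> (nat \<Rightarrow> (nat \<times> nat) set) \<Rightarrow> nat set set \<Rightarrow> nat \<Rightarrow> real" where
  "signature_matrix m Ds M j = of_int (matching_sign m (Ds j) M)"

definition pfaffian_k_orientation ::
    "nat \<Rightarrow> nat set set \<Rightarrow> nat \<Rightarrow> (nat \<Rightarrow> (nat \<times> nat) set) \<Rightarrow> bool" where
  "pfaffian_k_orientation m E k Ds \<longleftrightarrow>
     k_orientation E k Ds \<and>
     (\<exists>x :: nat \<Rightarrow> real. \<forall>M. perfect_matching m E M \<longrightarrow>
        (\<Sum>j=1..k. signature_matrix m Ds M j * x j) = 1)"

definition k_pfaffian :: "nat \<Rightarrow> nat set set \<Rightarrow> nat \<Rightarrow> bool" where
  "k_pfaffian m E k \<longleftrightarrow> (\<exists>Ds. pfaffian_k_orientation m E k Ds)"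

definition pfaffian_number :: "nat \<Rightarrow> nat set set \<Rightarrow> nat" where
  "pfaffian_number m E = (LEAST k. 1 \<le> k \<and> k_pfaffian m E k)"

text \<open>Edge set of the complete graph on the vertices \<open>1, \<dots>, N\<close>.\<close>

definition complete_graph_edges :: "nat \<Rightarrow> nat set set" where
  "complete_graph_edges N = nsets {1..N} 2"

lemma lists_matching_sign_unique:
  assumes p: "lists_matching m D M p" and q: "lists_matching m D M q"
  shows "sign p = sign q"
proof -
  define I where "I = {1..m}"
  define f where "f = (\<lambda>i. (p (2*i - 1), p (2*i)))"
  define g where "g = (\<lambda>i. (q (2*i - 1), q (2*i)))"
  have pp: "p permutes {1..2*m}" and qp: "q permutes {1..2*m}"
    using p q by (auto simp: lists_matching_def)
  have fg: "f ` I = g ` I"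
    using p q by (simp add: lists_matching_def f_def g_def I_def)
  have f: "inj_on f I"
  proof (rule inj_onI)
    fix i j assume "f i = f j"
    hence "p (2*i) = p (2*j)" by (simp add: f_def)
    thus "i = j" using permutes_inj[OF pp] by (simp add: inj_eq)
  qed
  have g: "inj_on g I"
  proof (rule inj_onI)
    fix i j assume "g i = g j"
    hence "q (2*i) = q (2*j)" by (simp add: g_def)
    thus "i = j" using permutes_inj[OF qp] by (simp add: inj_eq)
  qed
  define r where "r = (\<lambda>i. if i \<in> I then inv_into I f (g i) else i)"
  have fr: "f (r i) = g i" and rI: "r i \<in> I" if "i \<in> I" for i
  proof -
    have "g i \<in> f ` I" using that fg by auto
    thus "f (r i) = g i" "r i \<in> I"
      using that by (auto simp: r_def f_inv_into_f inv_into_into)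
  qed
  have "inj_on r I"
  proof (rule inj_onI)
    fix i j assume ij: "i \<in> I" "j \<in> I" "r i = r j"
    hence "g i = g j" using fr[of i] fr[of j] by simp
    thus "i = j" using ij g by (auto dest: inj_onD)
  qed
  moreover have "r ` I \<subseteq> I" using rI by auto
  moreover have "finite I" by (simp add: I_def)
  ultimately have rbij: "bij_betw r I I"
    by (simp add: bij_betw_def endo_inj_surj)
  have rp: "r permutes I"
    by (rule bij_imp_permutes[OF rbij]) (auto simp: r_def)
  define a where "a = (\<lambda>i::nat. 2*i)"
  define b where "b = (\<lambda>i::nat. 2*i - 1)"
  have ai: "inj_on a I" and bi: "inj_on b I"
    by (auto simp: inj_on_def a_def b_def I_def)
  define s where "s = map_permutation I a r"
  define t where "t = map_permutation I b r"
  have sp: "s permutes a ` I" and tp: "t permutes b ` I"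
    unfolding s_def t_def
    by (auto intro!: map_permutation_permutes simp: inj_on_imp_bij_betw ai bi rp)
  have fin: "finite (a ` I)" "finite (b ` I)"
    by (auto simp: I_def)
  have ab: "a i \<noteq> b j" if "j \<in> I" for i j
  proof -
    have "even (a i)" "odd (b j)" using that by (auto simp: a_def b_def I_def)
    thus ?thesis by metis
  qed
  have st: "sign (s \<circ> t) = 1"
  proof -
    have "sign (s \<circ> t) = sign s * sign t"
      using sp tp fin by (intro sign_compose) (auto simp: permutation_permutes)
    also have "sign s = sign r"
      unfolding s_def by (rule sign_map_permutation) (use ai rp I_def in auto)
    also have "sign t = sign r"
      unfolding t_def by (rule sign_map_permutation) (use bi rp I_def in auto)
    finally show ?thesis by (simp only: sign_idempotent)
  qed
  have q_eq: "q = p \<circ> (s \<circ> t)"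
  proof
    fix x
    consider (e) i where "i \<in> I" "x = a i" | (o) i where "i \<in> I" "x = b i" | (n) "x \<notin> {1..2*m}"
    proof (cases "x \<in> {1..2*m}")
      case True
      show ?thesis
      proof (cases "even x")
        case True
        with \<open>x \<in> {1..2*m}\<close> show ?thesis
          by (intro that(1)[of "x div 2"]) (auto simp: a_def I_def)
      next
        case False
        with \<open>x \<in> {1..2*m}\<close> show ?thesis
          by (intro that(2)[of "(x + 1) div 2"]) (auto simp: b_def I_def elim!: oddE)
      qed
    qed (use that in auto)
    thus "q x = (p \<circ> (s \<circ> t)) x"
    proof cases
      case e
      have "t x = x"
        using permutes_not_in[OF tp, of x] ab e by auto
      moreover have "s x = a (r i)"
        unfolding s_def using map_permutation_apply[OF ai] e by auto
      ultimately show ?thesis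
        using fr[of i] e by (auto simp: f_def g_def a_def)
    next
      case o
      have "t x = b (r i)"
        unfolding t_def using map_permutation_apply[OF bi] o by auto
      moreover have "s (b (r i)) = b (r i)"
        using permutes_not_in[OF sp, of "b (r i)"] ab rI[OF o(1)] by force
      ultimately show ?thesis
        using fr[of i] o by (auto simp: f_def g_def b_def)
    next
      case n
      have "x \<notin> a ` I" "x \<notin> b ` I"
        using n by (auto simp: a_def b_def I_def)
      thus ?thesis
        using n permutes_not_in[OF sp, of x] permutes_not_in[OF tp, of x]
          permutes_not_in[OF pp, of x] permutes_not_in[OF qp, of x] by simp
    qed
  qed
  have "sign q = sign p * sign (s \<circ> t)"
    unfolding q_eq
  proof (rule sign_compose)
    show "permutation p"
      using pp by (auto simp: permutation_permutes)
    have "permutation s" "permutation t"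
      using sp tp fin by (auto simp: permutation_permutes)
    thus "permutation (s \<circ> t)" by (rule permutation_compose)
  qed
  thus ?thesis using st by simp
qed

lemma lists_matching_exists:
  assumes E: "E \<subseteq> nsets {1..2*m} 2" and D: "orientation E D" and M: "perfect_matching m E M"
  shows "\<exists>p. lists_matching m D M p"
proof -
  define A where "A = {(u, v) \<in> D. {u, v} \<in> M}"
  have ME: "M \<subseteq> E" and M1: "\<And>v. v \<in> {1..2*m} \<Longrightarrow> \<exists>!e. e \<in> M \<and> v \<in> e"
    using M by (auto simp: perfect_matching_def)
  have card2: "card e = 2" "e \<subseteq> {1..2*m}" "finite e" if "e \<in> M" for e
    using that ME E by (auto simp: nsets_def)
  have un: "\<Union>M = {1..2*m}" using M1 card2(2) by blast
  have disj: "disjoint M"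
    unfolding disjoint_def using M1 card2(2) by blast
  have "2 * card M = card (\<Union>M)"
    using card2 disj by (simp add: card_Union_disjoint)
  hence cM: "card M = m" using un by simp
  have bijD: "bij_betw (\<lambda>(u, v). {u, v}) D E" using D by (simp add: orientation_def)
  have imA: "(\<lambda>(u, v). {u, v}) ` A = M"
  proof
    show "M \<subseteq> (\<lambda>(u, v). {u, v}) ` A"
    proof
      fix e assume e: "e \<in> M"
      hence "e \<in> (\<lambda>(u, v). {u, v}) ` D" using ME bijD by (auto simp: bij_betw_def)
      thus "e \<in> (\<lambda>(u, v). {u, v}) ` A" using e by (force simp: A_def)
    qed
  qed (auto simp: A_def)
  have "inj_on (\<lambda>(u, v). {u, v}) A"
    using bijD by (rule inj_on_subset[OF bij_betw_imp_inj_on]) (auto simp: A_def)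
  hence cA: "card A = m" using cM imA card_image by fastforce
  have finM: "finite M" using un by (metis finite_UnionD finite_atLeastAtMost)
  have "finite A"
    using finM imA \<open>inj_on _ A\<close> finite_image_iff by blast
  then obtain h where h: "bij_betw h {1..m} A"
    using cA by (metis card_atLeastAtMost diff_Suc_1 finite_atLeastAtMost finite_same_card_bij)
  define p where "p = (\<lambda>x. if x \<in> {1..2*m} then
      (if even x then snd (h (x div 2)) else fst (h ((x + 1) div 2))) else x)"
  have ph: "(p (2*i - 1), p (2*i)) = h i" if "i \<in> {1..m}" for i
  proof -
    have "odd (2*i - 1)" "(2*i - 1 + 1) div 2 = i" "2*i - 1 \<in> {1..2*m}" "2*i \<in> {1..2*m}"
      using that by (auto)
    thus ?thesis by (simp add: p_def)
  qed
  have im: "(\<lambda>i. (p (2*i - 1), p (2*i))) ` {1..m} = A"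
    using ph h by (auto simp: bij_betw_def)
  have "{1..2*m} \<subseteq> p ` {1..2*m}"
  proof
    fix v assume "v \<in> {1..2*m}"
    then obtain e where e: "e \<in> M" "v \<in> e" using un by blast
    then obtain c d where cd: "(c, d) \<in> A" "e = {c, d}" using imA by auto
    then obtain i where i: "i \<in> {1..m}" "p (2*i - 1) = c" "p (2*i) = d"
      using im by (smt (verit) image_iff prod.inject)
    have "2*i - 1 \<in> {1..2*m}" "2*i \<in> {1..2*m}" using i(1) by auto
    thus "v \<in> p ` {1..2*m}" using i cd e by blast
  qed
  hence "p ` {1..2*m} = {1..2*m}"
    by (intro card_seteq[symmetric] card_image_le) auto
  hence "bij_betw p {1..2*m} {1..2*m}"
    by (simp add: bij_betw_def finite_surj_inj)
  hence "p permutes {1..2*m}"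
    by (rule bij_imp_permutes) (unfold p_def, simp only: if_False)
  thus ?thesis using im by (auto simp: lists_matching_def A_def)
qed

end

theory Submission
  imports Defs "Jordan_Normal_Form.Determinant"
begin

text \<open>
  Consider the \<open>n!\<close> perfect matchings of \<open>K\<^bsub>2n\<^esub>\<close> that join odd vertices to even vertices. Such a
  matching is a permutation \<open>p\<close>, and its sign in the orientation \<open>D\<^sub>j\<close> is
  \<open>sign p * a\<^sub>j p\<close>, where \<open>a\<^sub>j p\<close> is the product of the entries \<open>b\<^sub>j i (p i)\<close> of a matrix \<open>b\<^sub>j\<close>
  with entries \<open>1\<close> and \<open>-1\<close> (\<open>matching_sign_bipartite\<close>). In a pfaffian \<open>k\<close>-orientation some fixed
  linear form takes the value \<open>1\<close> on all sign vectors, so it takes the value \<open>sign p\<close> on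
  \<open>(a\<^sub>1 p, \<dots>, a\<^sub>k p)\<close>: the vector \<open>a p\<close> determines \<open>sign p\<close>.

  Hence each fibre of \<open>a\<close> consists of permutations of one sign, and its cardinality is, up to
  sign, the sum of \<open>sign p\<close> over the fibre. Expanding the indicator function of the fibre into
  characters of \<open>{1, -1}\<^sup>k\<close> writes this sum as an average of \<open>2 ^ k\<close> determinants, up to sign, of
  entrywise products of the \<open>b\<^sub>j\<close>. By Hadamard's inequality each of these is at most
  \<open>sqrt (n ^ n)\<close> in absolute value. As there are at most \<open>2 ^ k\<close> fibres, \<open>n! \<le> 2 ^ k * sqrt (n ^ n)\<close>
  (\<open>card_permutations_le_of_sign_determined\<close>), and \<open>n! \<ge> (n/e) ^ n\<close> gives
  \<open>k \<ge> n log\<^sub>2 n / 2 - O(n)\<close>.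

  The pfaffian number is a least element, so the bound applies to it only because some pfaffian
  \<open>k\<close>-orientation exists (\<open>exists_k_pfaffian\<close>). The family of all orientations is one: reversing an
  edge that lies in just one of two perfect matchings changes exactly one of their two signs, so
  the rows of the signature matrix are pairwise orthogonal, and a suitable multiple of the sum of
  the rows is the required solution.
\<close>

section \<open>Hadamard's inequality\<close>

lemma scalar_prod_real_self_nonneg:
  "0 \<le> (v :: real vec) \<bullet> v"
  unfolding scalar_prod_def by (intro sum_nonneg) auto

lemma scalar_prod_real_self_eq_0:
  fixes v w :: "real vec"
  assumes "dim_vec v = dim_vec w" and "v \<bullet> v = 0"
  shows "w \<bullet> v = 0"
proof -
  have "\<forall>i\<in>{0..<dim_vec v}. v $ i * v $ i = 0"
    using assms(2) unfolding scalar_prod_def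
    by (subst (asm) sum_nonneg_eq_0_iff) auto
  thus ?thesis by (simp add: scalar_prod_def)
qed

text \<open>
  One step of the Gram--Schmidt process on the rows of a matrix, without normalization: it makes
  row \<open>m\<close> orthogonal to row \<open>l\<close>.
\<close>

lemma orthogonalize_row_step:
  fixes A :: "real mat"
  assumes A: "A \<in> carrier_mat n n" and ml: "m < n" "l < n" "m \<noteq> l"
  obtains c B where "B \<in> carrier_mat n n" "det B = det A"
    "row B m = c \<cdot>\<^sub>v row A l + row A m" "\<And>i. i < n \<Longrightarrow> i \<noteq> m \<Longrightarrow> row B i = row A i"
    "row B m \<bullet> row B m \<le> row A m \<bullet> row A m" "row B m \<bullet> row A l = 0"
proof -
  define x where "x = row A m \<bullet> row A l"
  define L where "L = row A l \<bullet> row A l"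
  define c where "c = - x / L"
  define B where "B = addrow c m l A"
  have dims: "row A i \<in> carrier_vec n" for i using A by auto
  have B: "B \<in> carrier_mat n n" using A by (simp add: B_def mat_addrow_def)
  have "det B = det A" unfolding B_def by (rule det_addrow) (use A ml in auto)
  have Bm: "row B m = c \<cdot>\<^sub>v row A l + row A m"
    unfolding B_def by (rule eq_vecI) (use A ml in auto)
  have Bi: "row B i = row A i" if "i < n" "i \<noteq> m" for i
    unfolding B_def by (rule eq_vecI) (use A ml that in auto)
  \<comment> \<open>if row \<open>l\<close> vanishes, then \<open>c = 0\<close> by the convention for division by zero\<close>
  have x0: "x = 0" if "L = 0"
    unfolding x_def by (rule scalar_prod_real_self_eq_0) (use that in \<open>simp_all add: L_def\<close>)
  have comm: "row A l \<bullet> row A m = x"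
    unfolding x_def by (rule comm_scalar_prod[OF dims dims])
  have "row B m \<bullet> row A l = c * L + x"
    unfolding Bm using dims
    by (simp add: add_scalar_prod_distrib[of _ n] x_def L_def)
  also have "\<dots> = 0" using x0 by (simp add: c_def)
  finally have orth: "row B m \<bullet> row A l = 0" .
  have "row B m \<bullet> row B m = row B m \<bullet> (c \<cdot>\<^sub>v row A l) + row B m \<bullet> row A m"
    using dims B by (subst (2) Bm, intro scalar_prod_add_distrib[of _ n]) auto
  also have "row B m \<bullet> (c \<cdot>\<^sub>v row A l) = 0"
    using orth A B by simp
  also have "row B m \<bullet> row A m = c * x + row A m \<bullet> row A m"
    unfolding Bm using dims by (simp add: add_scalar_prod_distrib[of _ n] comm)
  also have "c * x \<le> 0"
    using scalar_prod_real_self_nonneg[of "row A l"]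
    by (simp add: c_def L_def divide_nonneg_nonneg)
  finally have le: "row B m \<bullet> row B m \<le> row A m \<bullet> row A m" by simp
  show thesis by (rule that[of B c]) (use B \<open>det B = det A\<close> Bm Bi le orth in simp_all)
qed

text \<open>
  The Gram--Schmidt process changes the first \<open>m\<close> rows into pairwise orthogonal ones. It preserves
  the determinant, and no row becomes longer.
\<close>

lemma exists_orthogonal_rows:
  fixes A :: "real mat"
  assumes A: "A \<in> carrier_mat n n" and m: "m \<le> n"
  shows "\<exists>B\<in>carrier_mat n n. det B = det A \<and> (\<forall>i<n. row B i \<bullet> row B i \<le> row A i \<bullet> row A i) \<and>
           (\<forall>j<m. \<forall>i<j. row B j \<bullet> row B i = 0)"
  using m
proof (induction m)
  case 0
  thus ?case using A by auto
next
  case (Suc m)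
  \<comment> \<open>row \<open>m\<close> is made orthogonal to the rows \<open>0, \<dots>, m - 1\<close> one after the other\<close>
  have "\<exists>B\<in>carrier_mat n n. det B = det A \<and>
          (\<forall>i<n. row B i \<bullet> row B i \<le> row A i \<bullet> row A i) \<and>
          (\<forall>j<m. \<forall>i<j. row B j \<bullet> row B i = 0) \<and> (\<forall>i<l. row B m \<bullet> row B i = 0)"
    if "l \<le> m" for l
    using that
  proof (induction l)
    case 0
    thus ?case using Suc by simp
  next
    case (Suc l)
    then obtain B where B: "B \<in> carrier_mat n n" "det B = det A"
      and le: "\<And>i. i < n \<Longrightarrow> row B i \<bullet> row B i \<le> row A i \<bullet> row A i"
      and o1: "\<And>i j. j < m \<Longrightarrow> i < j \<Longrightarrow> row B j \<bullet> row B i = 0"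
      and o2: "\<And>i. i < l \<Longrightarrow> row B m \<bullet> row B i = 0" by auto
    have lm: "m < n" "l < n" "m \<noteq> l" "l < m" using Suc \<open>Suc m \<le> n\<close> by auto
    have dims: "row B i \<in> carrier_vec n" for i using B by auto
    obtain c C where C: "C \<in> carrier_mat n n" "det C = det B"
      and Cm: "row C m = c \<cdot>\<^sub>v row B l + row B m"
      and Ci: "\<And>i. i < n \<Longrightarrow> i \<noteq> m \<Longrightarrow> row C i = row B i"
      and Cle: "row C m \<bullet> row C m \<le> row B m \<bullet> row B m"
      and Co: "row C m \<bullet> row B l = 0"
      using orthogonalize_row_step[OF B(1) lm(1-3)] by metis
    have "row C m \<bullet> row C i = 0" if i: "i < Suc l" for i
    proof (cases "i = l")
      case True
      thus ?thesis using Co Ci lm by simp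
    next
      case False
      hence "i < l" using i by simp
      hence "row B l \<bullet> row B i = 0" "row B m \<bullet> row B i = 0" "row C i = row B i"
        using o1[of l i] o2 lm Ci by auto
      thus ?thesis
        using dims by (simp add: Cm add_scalar_prod_distrib[of _ n])
    qed
    moreover have "row C i \<bullet> row C i \<le> row A i \<bullet> row A i" if "i < n" for i
      using le[OF that] Cle Ci[OF that] by (cases "i = m") auto
    moreover have "row C j \<bullet> row C i = 0" if "j < m" "i < j" for i j
      using o1[OF that] that lm Ci by simp
    ultimately show ?case using C B by (intro bexI[of _ C]) auto
  qed
  from this[of m] show ?case by (auto simp: less_Suc_eq)
qed

theorem hadamard_inequality:
  fixes A :: "real mat"
  assumes A: "A \<in> carrier_mat n n"
  shows "(det A)\<^sup>2 \<le> (\<Prod>i<n. row A i \<bullet> row A i)"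
proof -
  obtain B where B: "B \<in> carrier_mat n n" "det B = det A"
    and le: "\<And>i. i < n \<Longrightarrow> row B i \<bullet> row B i \<le> row A i \<bullet> row A i"
    and orth: "\<And>i j. j < n \<Longrightarrow> i < j \<Longrightarrow> row B j \<bullet> row B i = 0"
    using exists_orthogonal_rows[OF A order_refl] by auto
  \<comment> \<open>the Gram matrix of the rows of \<open>B\<close> is diagonal\<close>
  define G where "G = B * transpose_mat B"
  have G: "G \<in> carrier_mat n n" using B by (simp add: G_def)
  have "(det A)\<^sup>2 = det G"
    unfolding G_def using B
    by (subst det_mult[of _ n]) (auto simp: det_transpose[of _ n] power2_eq_square)
  also have "\<dots> = prod_list (diag_mat G)"
    by (rule det_upper_triangular[OF _ G]) (use B orth in \<open>auto simp: upper_triangular_def G_def\<close>)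
  also have "\<dots> = (\<Prod>i<n. row B i \<bullet> row B i)"
    using B G by (simp add: diag_mat_def prod.list_conv_set_nth atLeast0LessThan G_def)
  also have "\<dots> \<le> (\<Prod>i<n. row A i \<bullet> row A i)"
    by (intro prod_mono) (auto simp: le scalar_prod_real_self_nonneg)
  finally show ?thesis .
qed

lemma hadamard_inequality_sign_matrix:
  fixes A :: "real mat"
  assumes A: "A \<in> carrier_mat n n"
    and entries: "\<And>i j. i < n \<Longrightarrow> j < n \<Longrightarrow> \<bar>A $$ (i, j)\<bar> = 1"
  shows "\<bar>det A\<bar> \<le> sqrt (real n ^ n)"
proof -
  have "row A i \<bullet> row A i = real n" if "i < n" for i
  proof -
    have "row A i \<bullet> row A i = (\<Sum>j = 0..<n. (A $$ (i, j))\<^sup>2)"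
      using A that by (auto simp: scalar_prod_def power2_eq_square)
    also have "\<dots> = (\<Sum>j = 0..<n. 1)"
      using entries that by (intro sum.cong refl) (metis atLeastLessThan_iff one_power2 power2_abs)
    finally show ?thesis by simp
  qed
  hence "(det A)\<^sup>2 \<le> real n ^ n" using hadamard_inequality[OF A] by simp
  thus ?thesis by (metis real_sqrt_abs real_sqrt_le_mono)
qed

section \<open>Permutations whose sign is determined by entry products\<close>

text \<open>
  If the \<open>J\<close>-indexed vector of products \<open>\<Prod>i<n. b j i (p i)\<close> determines the sign of the permutation
  \<open>p\<close>, then no fibre of this vector has more than \<open>sqrt (n ^ n)\<close> elements, which bounds the number
  of all permutations.
\<close>

lemma card_permutations_le_of_sign_determined:
  fixes b :: "'j \<Rightarrow> nat \<Rightarrow> nat \<Rightarrow> real" and n :: nat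
  assumes J: "finite J" and b: "\<And>j i l. j \<in> J \<Longrightarrow> \<bar>b j i l\<bar> = 1"
    and determined: "\<And>p q. p permutes {0..<n} \<Longrightarrow> q permutes {0..<n} \<Longrightarrow>
          (\<And>j. j \<in> J \<Longrightarrow> (\<Prod>i=0..<n. b j i (p i)) = (\<Prod>i=0..<n. b j i (q i))) \<Longrightarrow>
          sign p = sign q"
  shows "fact n \<le> 2 ^ card J * sqrt (real n ^ n)"
proof -
  define P where "P = {p. p permutes {0..<n}}"
  define a where "a = (\<lambda>p j. \<Prod>i=0..<n. b j i (p i))"
  have finP: "finite P" unfolding P_def by (rule finite_permutations) simp
  have a1: "a p j = 1 \<or> a p j = -1" if "j \<in> J" for p j
  proof -
    have "\<bar>a p j\<bar> = 1" using b that by (simp add: a_def abs_prod)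
    thus ?thesis by linarith
  qed
  define H where "H = sqrt (real n ^ n)"
  define F where "F = (\<lambda>T. {p \<in> P. {j \<in> J. a p j = 1} = T})"
  have fibre: "real (card (F T)) \<le> H" if T: "T \<subseteq> J" for T
  proof -
    define v :: "'j \<Rightarrow> real" where "v = (\<lambda>j. if j \<in> T then 1 else -1)"
    \<comment> \<open>Each factor is \<open>2\<close> or \<open>0\<close>, so the product is \<open>2 ^ card J\<close> times the indicator function of the
      fibre; expanding it gives the characters of the sign group.\<close>
    have ind: "(\<Prod>j\<in>J. v j * a p j + 1) = (if p \<in> F T then 2 ^ card J else 0)" if "p \<in> P" for p
    proof (cases "p \<in> F T")
      case True
      have "v j * a p j = 1" if "j \<in> J" for j
        using True a1[OF that, of p] that by (auto simp: F_def v_def)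
      thus ?thesis using True by simp
    next
      case False
      then obtain j where "j \<in> J" "\<not> (a p j = 1 \<longleftrightarrow> j \<in> T)"
        using \<open>p \<in> P\<close> T by (auto simp: F_def)
      hence "v j * a p j + 1 = 0" using a1[of j p] by (auto simp: v_def)
      thus ?thesis using False J \<open>j \<in> J\<close> by (auto intro: prod_zero)
    qed
    have const: "\<bar>\<Sum>p\<in>F T. of_int (sign p) :: real\<bar> = card (F T)"
    proof (cases "F T = {}")
      case False
      then obtain q where q: "q \<in> F T" by blast
      have "sign p = sign q" if p: "p \<in> F T" for p
      proof (rule determined)
        show "p permutes {0..<n}" "q permutes {0..<n}" using p q by (auto simp: F_def P_def)
        show "(\<Prod>i=0..<n. b j i (p i)) = (\<Prod>i=0..<n. b j i (q i))" if j: "j \<in> J" for j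
        proof -
          have "a p j = 1 \<longleftrightarrow> a q j = 1" using p q j by (auto simp: F_def)
          hence "a p j = a q j" using a1[OF j] by metis
          thus ?thesis by (simp add: a_def)
        qed
      qed
      hence "(\<Sum>p\<in>F T. of_int (sign p) :: real) = card (F T) * of_int (sign q)" by simp
      thus ?thesis by (simp add: abs_mult sign_def)
    qed simp
    have "2 ^ card J * (\<Sum>p\<in>F T. of_int (sign p) :: real)
        = (\<Sum>p\<in>P. of_int (sign p) * (if p \<in> F T then 2 ^ card J else 0))"
      using finP by (simp add: sum_distrib_left F_def sum.If_cases if_distrib Collect_conj_eq mult.commute cong: if_cong)
    also have "\<dots> = (\<Sum>p\<in>P. of_int (sign p) * (\<Prod>j\<in>J. v j * a p j + 1))"
      by (intro sum.cong) (simp_all add: ind)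
    also have "\<dots> = (\<Sum>p\<in>P. \<Sum>S\<in>Pow J. of_int (sign p) * (\<Prod>j\<in>S. v j * a p j))"
      by (simp add: prod_add[OF J] sum_distrib_left)
    also have "\<dots> = (\<Sum>S\<in>Pow J. \<Sum>p\<in>P. of_int (sign p) * (\<Prod>j\<in>S. v j * a p j))"
      by (rule sum.swap)
    also have "\<dots> = (\<Sum>S\<in>Pow J. (\<Prod>j\<in>S. v j) * det (mat n n (\<lambda>(i, l). \<Prod>j\<in>S. b j i l)))"
    proof (intro sum.cong refl)
      fix S assume "S \<in> Pow J"
      have "det (mat n n (\<lambda>(i, l). \<Prod>j\<in>S. b j i l))
          = (\<Sum>p\<in>P. of_int (sign p) * (\<Prod>i=0..<n. \<Prod>j\<in>S. b j i (p i)))"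
        unfolding P_def
        by (subst det_def'[of _ n])
           (auto intro!: sum.cong prod.cong simp: permutes_in_image[of _ "{0..<n}", simplified])
      also have "\<dots> = (\<Sum>p\<in>P. of_int (sign p) * (\<Prod>j\<in>S. a p j))"
        unfolding a_def by (subst prod.swap) simp
      finally show "(\<Sum>p\<in>P. of_int (sign p) * (\<Prod>j\<in>S. v j * a p j))
          = (\<Prod>j\<in>S. v j) * det (mat n n (\<lambda>(i, l). \<Prod>j\<in>S. b j i l))"
        by (simp add: prod.distrib sum_distrib_left mult_ac)
    qed
    finally have "2 ^ card J * real (card (F T))
        = \<bar>\<Sum>S\<in>Pow J. (\<Prod>j\<in>S. v j) * det (mat n n (\<lambda>(i, l). \<Prod>j\<in>S. b j i l))\<bar>"
      using const by (metis abs_mult abs_numeral power_abs)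
    also have "\<dots> \<le> (\<Sum>S\<in>Pow J. H)"
    proof (rule order_trans[OF sum_abs], rule sum_mono)
      fix S assume "S \<in> Pow J"
      hence "\<bar>det (mat n n (\<lambda>(i, l). \<Prod>j\<in>S. b j i l))\<bar> \<le> H"
        unfolding H_def using b
        by (intro hadamard_inequality_sign_matrix) (auto simp: abs_prod intro!: prod.neutral)
      moreover have "\<bar>\<Prod>j\<in>S. v j\<bar> = 1"
        by (auto simp: abs_prod v_def intro!: prod.neutral)
      ultimately show "\<bar>(\<Prod>j\<in>S. v j) * det (mat n n (\<lambda>(i, l). \<Prod>j\<in>S. b j i l))\<bar> \<le> H"
        by (simp add: abs_mult)
    qed
    also have "\<dots> = 2 ^ card J * H" using J by (simp add: card_Pow)
    finally show ?thesis by simp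
  qed
  have "fact n = real (card P)"
    unfolding P_def using card_permutations[of "{0..<n}" n] by simp
  also have "card P = (\<Sum>T\<in>Pow J. card (F T))"
  proof -
    have "(\<Sum>T\<in>Pow J. card (F T)) = (\<Sum>T\<in>Pow J. \<Sum>p | p \<in> P \<and> {j \<in> J. a p j = 1} = T. 1)"
      by (simp add: F_def)
    also have "\<dots> = (\<Sum>p\<in>P. 1)"
      using finP J by (intro sum.group) auto
    finally show ?thesis by simp
  qed
  also have "real \<dots> \<le> (\<Sum>T\<in>Pow J. H)"
    unfolding of_nat_sum by (intro sum_mono fibre) auto
  also have "\<dots> = 2 ^ card J * H" using J by (simp add: card_Pow)
  finally show ?thesis by (simp add: H_def)
qed

lemma power_self_le_exp_fact: "real n ^ n \<le> exp (real n) * fact n"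
proof -
  have "(\<Sum>i\<in>{n}. real n ^ i /\<^sub>R fact i) \<le> exp (real n)"
    unfolding exp_def by (intro sum_le_suminf summable_exp_generic) auto
  thus ?thesis by (simp add: field_simps)
qed

text \<open>
  The estimate gives \<open>k ln 2 \<ge> n (ln n / 2 - 1)\<close>. For \<open>n \<ge> exp 4\<close> the term \<open>1\<close> is at most \<open>ln n / 4\<close>, which
  leaves the constant \<open>1/4\<close>.
\<close>

lemma log_bound_of_fact_bound:
  assumes le: "fact n \<le> 2 ^ k * sqrt (real n ^ n)" and n: "exp 4 \<le> real n"
  shows "1/4 * real n * log 2 (real n) \<le> real k"
proof -
  have n0: "0 < real n" using n exp_gt_zero[of "4::real"] by linarith
  have ln4: "4 \<le> ln (real n)" using n n0 by (simp add: ln_ge_iff)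
  have "real n ^ n \<le> exp (real n) * (2 ^ k * sqrt (real n ^ n))"
    using power_self_le_exp_fact[of n] le by (meson exp_ge_zero mult_left_mono order_trans)
  hence "ln (real n ^ n) \<le> ln (exp (real n) * (2 ^ k * sqrt (real n ^ n)))"
    using n0 by simp
  also have "\<dots> = real n + (real k * ln 2 + real n * ln (real n) / 2)"
    using n0 by (simp add: ln_mult ln_realpow ln_sqrt)
  finally have "real n * ln (real n) \<le> real n + (real k * ln 2 + real n * ln (real n) / 2)"
    using n0 by (simp add: ln_realpow)
  moreover have "real n * 4 \<le> real n * ln (real n)"
    using ln4 n0 by simp
  ultimately have "real n * ln (real n) / 4 \<le> real k * ln 2" by linarith
  thus ?thesis by (simp add: log_def field_simps)
qed

section \<open>Signs of perfect matchings\<close>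

text \<open>
  The set of edges joining the values of \<open>q\<close> at the positions \<open>2i - 1\<close> and \<open>2i\<close>, for \<open>i\<close> from \<open>1\<close> to \<open>m\<close>,
  that is, the matching listed by \<open>q\<close> when orientations are disregarded.
\<close>

definition pair_matching :: "nat \<Rightarrow> (nat \<Rightarrow> nat) \<Rightarrow> nat set set" where
  "pair_matching m q = (\<lambda>i. {q (2*i - 1), q (2*i)}) ` {1..m}"

lemma pair_position:
  fixes w m :: nat
  assumes "w \<in> {1..2*m}"
  obtains i where "i \<in> {1..m}" "w = 2*i - 1 \<or> w = 2*i"
proof
  show "(w + 1) div 2 \<in> {1..m}" using assms by auto
  show "w = 2 * ((w + 1) div 2) - 1 \<or> w = 2 * ((w + 1) div 2)" using assms by auto
qed

lemma pair_matching_disjoint: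
  fixes i j m :: nat
  assumes q: "inj q" and ij: "i \<in> {1..m}" "j \<in> {1..m}"
    and v: "v \<in> {q (2*i - 1), q (2*i)}" "v \<in> {q (2*j - 1), q (2*j)}"
  shows "i = j"
proof -
  obtain a b where "v = q a" "a = 2*i - 1 \<or> a = 2*i" "v = q b" "b = 2*j - 1 \<or> b = 2*j"
    using v by blast
  moreover from this have "a = b" using q by (auto dest: injD)
  ultimately show ?thesis using ij by auto
qed

lemma perfect_matching_pair_matching:
  assumes q: "q permutes {1..2*m}" and E: "pair_matching m q \<subseteq> E"
  shows "perfect_matching m E (pair_matching m q)"
  unfolding perfect_matching_def
proof (intro conjI ballI)
  fix v assume v: "v \<in> {1..2*m}"
  then obtain w where w: "w \<in> {1..2*m}" "v = q w"
    using permutes_image[OF q] by blast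
  obtain i where i: "i \<in> {1..m}" "w = 2*i - 1 \<or> w = 2*i" using pair_position[OF w(1)] .
  have vi: "v \<in> {q (2*i - 1), q (2*i)}" using w i by auto
  show "\<exists>!e. e \<in> pair_matching m q \<and> v \<in> e"
  proof (rule ex1I[of _ "{q (2*i - 1), q (2*i)}"])
    show "{q (2*i - 1), q (2*i)} \<in> pair_matching m q \<and> v \<in> {q (2*i - 1), q (2*i)}"
      using i vi unfolding pair_matching_def by blast
  next
    fix e assume "e \<in> pair_matching m q \<and> v \<in> e"
    then obtain j where "j \<in> {1..m}" "e = {q (2*j - 1), q (2*j)}" "v \<in> {q (2*j - 1), q (2*j)}"
      unfolding pair_matching_def by blast
    thus "e = {q (2*i - 1), q (2*i)}"
      using pair_matching_disjoint[OF permutes_inj[OF q] i(1) _ vi] by blast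
  qed
qed (fact E)

lemma orientation_iff:
  assumes E: "E \<subseteq> nsets V 2"
  shows "orientation E D \<longleftrightarrow>
    (\<forall>u v. (u, v) \<in> D \<longrightarrow> {u, v} \<in> E) \<and>
    (\<forall>u v. {u, v} \<in> E \<longrightarrow> ((u, v) \<in> D \<longleftrightarrow> (v, u) \<notin> D))" (is "_ \<longleftrightarrow> ?R")
proof
  have ne: "u \<noteq> v" if "{u, v} \<in> E" for u v
    using that E by (auto simp: nsets_def)
  assume or: "orientation E D"
  hence inj: "inj_on (\<lambda>(u, v). {u, v}) D" and im: "(\<lambda>(u, v). {u, v}) ` D = E"
    by (auto simp: orientation_def bij_betw_def)
  show ?R
  proof (intro conjI allI impI iffI notI)
    show "{u, v} \<in> E" if "(u, v) \<in> D" for u v using im that by blast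
  next
    fix u v assume "{u, v} \<in> E" "(u, v) \<in> D" "(v, u) \<in> D"
    thus False using inj_onD[OF inj, of "(u, v)" "(v, u)"] ne by (auto simp: insert_commute)
  next
    fix u v assume *: "{u, v} \<in> E" "(v, u) \<notin> D"
    hence "{u, v} \<in> (\<lambda>(u, v). {u, v}) ` D" by (simp add: im)
    then obtain a b where "(a, b) \<in> D" "{a, b} = {u, v}" by auto
    thus "(u, v) \<in> D" using * by (auto simp: doubleton_eq_iff)
  qed
next
  assume R: ?R
  show "orientation E D"
    unfolding orientation_def bij_betw_def
  proof
    show "inj_on (\<lambda>(u, v). {u, v}) D"
      using R by (auto simp: inj_on_def doubleton_eq_iff)
    show "(\<lambda>(u, v). {u, v}) ` D = E"
    proof
      show "E \<subseteq> (\<lambda>(u, v). {u, v}) ` D"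
      proof
        fix e assume e: "e \<in> E"
        then obtain u v where "e = {u, v}" using E by (auto simp: nsets_def card_2_iff)
        moreover from this have "(u, v) \<in> D \<or> (v, u) \<in> D" using R e by blast
        ultimately show "e \<in> (\<lambda>(u, v). {u, v}) ` D"
          by (auto intro: image_eqI[of _ _ "(u, v)"] image_eqI[of _ _ "(v, u)"])
      qed
    qed (use R in auto)
  qed
qed

text \<open>Exchanging the two positions of each pair in \<open>S\<close> is a permutation of sign \<open>(-1) ^ card S\<close>.\<close>

lemma exists_pair_swaps:
  fixes m :: nat
  assumes "finite S" "S \<subseteq> {1..m}"
  shows "\<exists>r. r permutes {1..2*m} \<and> sign r = (-1) ^ card S \<and>
    (\<forall>i\<in>{1..m}. r (2*i - 1) = (if i \<in> S then 2*i else 2*i - 1) \<and>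
                 r (2*i) = (if i \<in> S then 2*i - 1 else 2*i))"
  using assms
proof (induction S rule: finite_induct)
  case empty
  thus ?case using permutes_id[of "{1..2*m}"] by (intro exI[of _ id]) (auto simp: id_def)
next
  case (insert j S)
  then obtain r where r: "r permutes {1..2*m}" "sign r = (-1) ^ card S"
    and r_odd: "\<And>i. i \<in> {1..m} \<Longrightarrow> r (2*i - 1) = (if i \<in> S then 2*i else 2*i - 1)"
    and r_even: "\<And>i. i \<in> {1..m} \<Longrightarrow> r (2*i) = (if i \<in> S then 2*i - 1 else 2*i)"
    by auto
  define t where "t = transpose (2*j - 1) (2*j)"
  have j: "1 \<le> j" "j \<le> m" using insert by auto
  have t: "t permutes {1..2*m}"
    unfolding t_def using j by (intro permutes_swap_id) auto
  have "sign t = -1" using j by (simp add: t_def sign_swap_id)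
  moreover have "permutation t" "permutation r"
    using t r(1) by (auto simp: permutation_permutes)
  ultimately have "sign (t \<circ> r) = (-1) ^ card (insert j S)"
    using insert r by (simp add: sign_compose)
  moreover have "(t \<circ> r) permutes {1..2*m}" by (rule permutes_compose[OF r(1) t])
  moreover have "(t \<circ> r) (2*i - 1) = (if i \<in> insert j S then 2*i else 2*i - 1) \<and>
      (t \<circ> r) (2*i) = (if i \<in> insert j S then 2*i - 1 else 2*i)" if i: "i \<in> {1..m}" for i
  proof (cases "i = j")
    case True
    thus ?thesis using r_odd[OF i] r_even[OF i] insert by (simp add: t_def)
  next
    case False
    hence "t (2*i) = 2*i" "t (2*i - 1) = 2*i - 1"
      unfolding t_def using i j by (auto intro!: transpose_apply_other)
    thus ?thesis using r_odd[OF i] r_even[OF i] False by simp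
  qed
  ultimately show ?case by blast
qed

text \<open>
  The sign of a matching computed from an arbitrary listing \<open>q\<close> of its edges: each edge listed
  against its orientation contributes a factor \<open>-1\<close>.
\<close>

lemma matching_sign_pair_matching:
  assumes E: "E \<subseteq> nsets {1..2*m} 2" and D: "orientation E D"
    and q: "q permutes {1..2*m}" and M: "pair_matching m q \<subseteq> E"
  shows "matching_sign m D (pair_matching m q) =
           sign q * (\<Prod>i=1..m. if (q (2*i - 1), q (2*i)) \<in> D then 1 else -1)"
proof -
  have D1: "{u, v} \<in> E" if "(u, v) \<in> D" for u v
    using D that unfolding orientation_iff[OF E] by blast
  have D2: "(u, v) \<in> D \<longleftrightarrow> (v, u) \<notin> D" if "{u, v} \<in> E" for u v
    using D that unfolding orientation_iff[OF E] by blast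
  have edge: "{q (2*i - 1), q (2*i)} \<in> E" if "i \<in> {1..m}" for i
    using M that by (auto simp: pair_matching_def)
  define S where "S = {i \<in> {1..m}. (q (2*i - 1), q (2*i)) \<notin> D}"
  have "finite S" "S \<subseteq> {1..m}" by (auto simp: S_def)
  from exists_pair_swaps[OF this] obtain r where r: "r permutes {1..2*m}" "sign r = (-1) ^ card S"
    and r_odd: "\<And>i. i \<in> {1..m} \<Longrightarrow> r (2*i - 1) = (if i \<in> S then 2*i else 2*i - 1)"
    and r_even: "\<And>i. i \<in> {1..m} \<Longrightarrow> r (2*i) = (if i \<in> S then 2*i - 1 else 2*i)"
    by blast
  define p where "p = q \<circ> r"
  have pD: "(p (2*i - 1), p (2*i)) \<in> D" if i: "i \<in> {1..m}" for i
    using D2[OF edge[OF i]] i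
    by (auto simp: p_def r_odd[OF i] r_even[OF i] S_def simp del: One_nat_def)
  have pe: "{p (2*i - 1), p (2*i)} = {q (2*i - 1), q (2*i)}" if i: "i \<in> {1..m}" for i
    by (simp add: p_def r_odd[OF i] r_even[OF i] insert_commute del: One_nat_def)
  have "lists_matching m D (pair_matching m q) p"
    unfolding lists_matching_def
  proof (intro conjI subset_antisym subsetI)
    show "p permutes {1..2*m}" unfolding p_def by (rule permutes_compose[OF r(1) q])
  next
    fix a assume "a \<in> (\<lambda>i. (p (2*i - 1), p (2*i))) ` {1..m}"
    thus "a \<in> {(u, v) \<in> D. {u, v} \<in> pair_matching m q}"
      using pD pe by (auto simp: pair_matching_def simp del: One_nat_def)
  next
    fix a assume "a \<in> {(u, v) \<in> D. {u, v} \<in> pair_matching m q}"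
    then obtain u v i where uv: "a = (u, v)" "(u, v) \<in> D" and i: "i \<in> {1..m}"
      "{u, v} = {q (2*i - 1), q (2*i)}"
      unfolding pair_matching_def by blast
    hence "{u, v} = {p (2*i - 1), p (2*i)}" using pe by simp
    hence "a = (p (2*i - 1), p (2*i))"
      using D2[OF D1[OF uv(2)]] uv pD[OF i(1)] by (auto simp: doubleton_eq_iff simp del: One_nat_def)
    thus "a \<in> (\<lambda>i. (p (2*i - 1), p (2*i))) ` {1..m}" using i by blast
  qed
  hence "matching_sign m D (pair_matching m q) = sign p"
    unfolding matching_sign_def by (metis lists_matching_sign_unique someI)
  also have "\<dots> = sign q * sign r"
    unfolding p_def using q r(1) by (intro sign_compose) (auto simp: permutation_permutes)
  also have "sign r = (\<Prod>i=1..m. if i \<in> S then -1 else 1)"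
    using \<open>S \<subseteq> {1..m}\<close> by (simp add: r(2) prod.If_cases Int_absorb1)
  also have "\<dots> = (\<Prod>i=1..m. if (q (2*i - 1), q (2*i)) \<in> D then 1 else -1)"
    by (intro prod.cong) (auto simp: S_def)
  finally show ?thesis .
qed

section \<open>Existence of pfaffian orientations\<close>

text \<open>Reversal of the arc on the edge \<open>e\<close>.\<close>

definition flip_edge :: "nat set \<Rightarrow> (nat \<times> nat) set \<Rightarrow> (nat \<times> nat) set" where
  "flip_edge e D = {(u, v). if {u, v} = e then (v, u) \<in> D else (u, v) \<in> D}"

lemma mem_flip_edge:
  "(u, v) \<in> flip_edge e D \<longleftrightarrow> (if {u, v} = e then (v, u) \<in> D else (u, v) \<in> D)"
  by (simp add: flip_edge_def)

lemma flip_edge_flip_edge: "flip_edge e (flip_edge e D) = D"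
proof -
  have "(u, v) \<in> flip_edge e (flip_edge e D) \<longleftrightarrow> (u, v) \<in> D" for u v
    by (metis mem_flip_edge insert_commute)
  thus ?thesis by auto
qed

lemma orientation_flip_edge:
  assumes E: "E \<subseteq> nsets V 2" and D: "orientation E D"
  shows "orientation E (flip_edge e D)"
  unfolding orientation_iff[OF E]
proof (intro conjI allI impI)
  have D1: "{u, v} \<in> E" if "(u, v) \<in> D" for u v
    using D that unfolding orientation_iff[OF E] by blast
  fix u v assume "(u, v) \<in> flip_edge e D"
  thus "{u, v} \<in> E" using D1[of u v] D1[of v u] by (metis mem_flip_edge insert_commute)
next
  fix u v assume "{u, v} \<in> E"
  hence "(u, v) \<in> D \<longleftrightarrow> (v, u) \<notin> D"
    using D unfolding orientation_iff[OF E] by blast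
  moreover have "{v, u} = e \<longleftrightarrow> {u, v} = e" by (simp add: insert_commute)
  ultimately show "(u, v) \<in> flip_edge e D \<longleftrightarrow> (v, u) \<notin> flip_edge e D"
    by (simp add: mem_flip_edge)
qed

lemma matching_sign_flip_edge:
  assumes E: "E \<subseteq> nsets {1..2*m} 2" and D: "orientation E D" and M: "perfect_matching m E M"
  shows "matching_sign m (flip_edge e D) M = (if e \<in> M then -1 else 1) * matching_sign m D M"
proof -
  obtain q where lm: "lists_matching m D M q" using lists_matching_exists[OF E D M] by blast
  hence q: "q permutes {1..2*m}"
    and im: "(\<lambda>i. (q (2*i - 1), q (2*i))) ` {1..m} = {(u, v) \<in> D. {u, v} \<in> M}"
    by (auto simp: lists_matching_def)
  have ME: "M \<subseteq> E" using M by (simp add: perfect_matching_def)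
  have qD: "(q (2*i - 1), q (2*i)) \<in> D" if "i \<in> {1..m}" for i using im that by blast
  have D2: "(u, v) \<in> D \<longleftrightarrow> (v, u) \<notin> D" if "{u, v} \<in> E" for u v
    using D that unfolding orientation_iff[OF E] by blast
  have MD: "(\<lambda>(u, v). {u, v}) ` {(u, v) \<in> D. {u, v} \<in> M} = M"
  proof
    show "M \<subseteq> (\<lambda>(u, v). {u, v}) ` {(u, v) \<in> D. {u, v} \<in> M}"
    proof
      fix e assume e: "e \<in> M"
      hence "e \<in> (\<lambda>(u, v). {u, v}) ` D" using ME D by (auto simp: orientation_def bij_betw_def)
      thus "e \<in> (\<lambda>(u, v). {u, v}) ` {(u, v) \<in> D. {u, v} \<in> M}" using e by force
    qed
  qed auto
  have Mq: "pair_matching m q = M"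
    using MD unfolding im[symmetric] pair_matching_def by (simp add: image_image)
  have PM: "pair_matching m q \<subseteq> E" using Mq ME by simp
  have "matching_sign m (flip_edge e D) M =
      sign q * (\<Prod>i=1..m. if (q (2*i - 1), q (2*i)) \<in> flip_edge e D then 1 else -1)"
    using matching_sign_pair_matching[OF E orientation_flip_edge[OF E D] q PM] Mq by simp
  also have "(\<Prod>i=1..m. if (q (2*i - 1), q (2*i)) \<in> flip_edge e D then 1 else -1 :: int)
      = (\<Prod>i=1..m. if {q (2*i - 1), q (2*i)} = e then -1 else 1)"
  proof (intro prod.cong refl)
    fix i assume i: "i \<in> {1..m}"
    hence "{q (2*i - 1), q (2*i)} \<in> E" using PM by (auto simp: pair_matching_def)
    hence "(q (2*i), q (2*i - 1)) \<notin> D" using D2 qD[OF i] by blast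
    thus "(if (q (2*i - 1), q (2*i)) \<in> flip_edge e D then 1 else -1 :: int)
        = (if {q (2*i - 1), q (2*i)} = e then -1 else 1)"
      using qD[OF i] by (simp add: flip_edge_def)
  qed
  also have "\<dots> = (if e \<in> M then -1 else 1)"
  proof (cases "e \<in> M")
    case True
    then obtain j where j: "j \<in> {1..m}" "e = {q (2*j - 1), q (2*j)}"
      using Mq by (auto simp: pair_matching_def)
    have "{q (2*i - 1), q (2*i)} = e \<longleftrightarrow> i = j" if "i \<in> {1..m}" for i
      using pair_matching_disjoint[OF permutes_inj[OF q] that j(1)] j(2) by blast
    hence "(\<Prod>i=1..m. if {q (2*i - 1), q (2*i)} = e then -1 else 1 :: int)
        = (\<Prod>i=1..m. if i = j then -1 else 1)"
      by (intro prod.cong) auto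
    thus ?thesis using True j by (simp add: prod.delta)
  next
    case False
    hence "{q (2*i - 1), q (2*i)} \<noteq> e" if "i \<in> {1..m}" for i
      using that Mq by (auto simp: pair_matching_def)
    hence "(\<Prod>i=1..m. if {q (2*i - 1), q (2*i)} = e then -1 else 1 :: int) = (\<Prod>i=1..m. 1)"
      by (intro prod.cong) auto
    thus ?thesis using False by simp
  qed
  also have "sign q = matching_sign m D M"
    unfolding matching_sign_def using lm by (metis lists_matching_sign_unique someI)
  finally show ?thesis by (simp add: mult.commute)
qed

lemma matching_sign_square: "matching_sign m D M * matching_sign m D M = 1"
  by (simp add: matching_sign_def sign_idempotent)

text \<open>
  The orientations of the graph, \<open>N\<close> in number, form together a pfaffian \<open>N\<close>-orientation.
\<close>

lemma exists_k_pfaffian: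
  assumes E: "E \<subseteq> nsets {1..2*m} 2"
  shows "\<exists>k\<ge>1. k_pfaffian m E k"
proof -
  define Or where "Or = {D. orientation E D}"
  define PM where "PM = {M. perfect_matching m E M}"
  define s :: "(nat \<times> nat) set \<Rightarrow> nat set set \<Rightarrow> real"
    where "s = (\<lambda>D M. of_int (matching_sign m D M))"
  have "finite E" using E by (rule finite_subset) (simp add: finite_imp_finite_nsets)
  moreover have "PM \<subseteq> Pow E" by (auto simp: PM_def perfect_matching_def)
  ultimately have finPM: "finite PM" by (meson finite_Pow_iff finite_subset)
  have "Or \<subseteq> Pow ({1..2*m} \<times> {1..2*m})"
  proof
    fix D assume "D \<in> Or"
    hence "{u, v} \<in> nsets {1..2*m} 2" if "(u, v) \<in> D" for u v
      using that E unfolding Or_def orientation_iff[OF E] by blast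
    thus "D \<in> Pow ({1..2*m} \<times> {1..2*m})" by (force simp: nsets_def)
  qed
  hence finOr: "finite Or" by (rule finite_subset) simp
  have "orientation E {(u, v). u < v \<and> {u, v} \<in> E}"
    unfolding orientation_iff[OF E]
  proof (intro conjI allI impI)
    fix u v assume "{u, v} \<in> E"
    hence "card {u, v} = 2" using E by (auto simp: nsets_def)
    hence "u \<noteq> v" by auto
    thus "(u, v) \<in> {(u, v). u < v \<and> {u, v} \<in> E} \<longleftrightarrow> (v, u) \<notin> {(u, v). u < v \<and> {u, v} \<in> E}"
      using \<open>{u, v} \<in> E\<close> by (auto simp: insert_commute)
  qed auto
  hence "Or \<noteq> {}" by (auto simp: Or_def)
  define N where "N = card Or"
  have N: "N > 0" using finOr \<open>Or \<noteq> {}\<close> by (simp add: N_def card_gt_0_iff)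
  have orth: "(\<Sum>D\<in>Or. s D M * s D M') = (if M = M' then real N else 0)"
    if MM: "M \<in> PM" "M' \<in> PM" for M M'
  proof (cases "M = M'")
    case True
    have "s D M * s D M = 1" for D
      unfolding s_def using matching_sign_square[of m D M] by (metis of_int_1 of_int_mult)
    thus ?thesis using True by (simp add: N_def)
  next
    case False
    \<comment> \<open>reversing \<open>e\<close> is an involution on orientations that negates each summand\<close>
    then obtain e where e: "(e \<in> M) \<noteq> (e \<in> M')" by blast
    have "(\<Sum>D\<in>Or. s D M * s D M') = (\<Sum>D\<in>Or. s (flip_edge e D) M * s (flip_edge e D) M')"
      by (rule sum.reindex_bij_witness[of _ "flip_edge e" "flip_edge e"])
         (auto simp: flip_edge_flip_edge Or_def orientation_flip_edge[OF E])
    also have "\<dots> = (\<Sum>D\<in>Or. - (s D M * s D M'))"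
    proof (intro sum.cong refl)
      fix D assume "D \<in> Or"
      thus "s (flip_edge e D) M * s (flip_edge e D) M' = - (s D M * s D M')"
        using MM e by (auto simp: s_def Or_def PM_def matching_sign_flip_edge[OF E])
    qed
    finally show ?thesis using False by (simp add: sum_negf)
  qed
  obtain h where h: "bij_betw h {1..N} Or"
    using finOr unfolding N_def
    by (metis card_atLeastAtMost diff_Suc_1 finite_atLeastAtMost finite_same_card_bij)
  define x where "x = (\<lambda>j. (\<Sum>M'\<in>PM. s (h j) M') / real N)"
  have "(\<Sum>j=1..N. signature_matrix m h M j * x j) = 1" if M: "perfect_matching m E M" for M
  proof -
    have "M \<in> PM" using M by (simp add: PM_def)
    have "(\<Sum>j=1..N. signature_matrix m h M j * x j)
        = (\<Sum>j=1..N. \<Sum>M'\<in>PM. s (h j) M * s (h j) M') / real N"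
      by (simp add: x_def signature_matrix_def s_def sum_distrib_left sum_divide_distrib)
    also have "(\<Sum>j=1..N. \<Sum>M'\<in>PM. s (h j) M * s (h j) M')
        = (\<Sum>D\<in>Or. \<Sum>M'\<in>PM. s D M * s D M')"
      by (rule sum.reindex_bij_betw[OF h])
    also have "\<dots> = (\<Sum>M'\<in>PM. \<Sum>D\<in>Or. s D M * s D M')" by (rule sum.swap)
    also have "\<dots> = (\<Sum>M'\<in>PM. if M = M' then real N else 0)"
      by (intro sum.cong refl orth \<open>M \<in> PM\<close>)
    also have "\<dots> = real N" using finPM \<open>M \<in> PM\<close> by simp
    finally show ?thesis using N by simp
  qed
  moreover have "k_orientation E N h"
    using h by (auto simp: k_orientation_def Or_def bij_betw_def)
  ultimately have "k_pfaffian m E N"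
    unfolding k_pfaffian_def pfaffian_k_orientation_def by blast
  thus ?thesis using N by (intro exI[of _ N]) auto
qed

lemma pfaffian_number_k_pfaffian:
  assumes E: "E \<subseteq> nsets {1..2*m} 2"
  shows "k_pfaffian m E (pfaffian_number m E)"
  unfolding pfaffian_number_def by (rule conjunct2[OF LeastI_ex[OF exists_k_pfaffian[OF E]]])

section \<open>The complete graph\<close>

text \<open>
  The permutation of \<open>{1..2*n}\<close> that fixes the odd numbers and acts as \<open>p\<close> on the even numbers, where
  \<open>2l + 2\<close> stands for \<open>l < n\<close>. The matching that it lists consists of the edges between \<open>2i + 1\<close> and
  \<open>2 * p i + 2\<close>.
\<close>

definition bipartite_permutation :: "nat \<Rightarrow> (nat \<Rightarrow> nat) \<Rightarrow> nat \<Rightarrow> nat" where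
  "bipartite_permutation n p = map_permutation {0..<n} (\<lambda>l. 2*l + 2) p"

lemma bipartite_permutation:
  assumes p: "p permutes {0..<n}"
  shows "bipartite_permutation n p permutes {1..2*n}"
    and "sign (bipartite_permutation n p) = sign p"
    and "i < n \<Longrightarrow> bipartite_permutation n p (2*i + 2) = 2 * p i + 2"
    and "bipartite_permutation n p (2*i + 1) = 2*i + 1"
proof -
  define f where "f = (\<lambda>l::nat. 2*l + 2)"
  have inj: "inj_on f {0..<n}" by (auto simp: f_def inj_on_def)
  have perm: "bipartite_permutation n p permutes f ` {0..<n}"
    unfolding bipartite_permutation_def f_def[symmetric]
    by (rule map_permutation_permutes[OF inj_on_imp_bij_betw[OF inj] p])
  show "bipartite_permutation n p permutes {1..2*n}"
    by (rule permutes_subset[OF perm]) (auto simp: f_def)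
  show "sign (bipartite_permutation n p) = sign p"
    unfolding bipartite_permutation_def f_def[symmetric]
    by (rule sign_map_permutation[OF inj p]) simp
  show "bipartite_permutation n p (2*i + 2) = 2 * p i + 2" if "i < n"
    using map_permutation_apply[OF inj, of i p] that
    unfolding bipartite_permutation_def f_def by simp
  have "2*i + 1 \<notin> f ` {0..<n}" unfolding f_def by auto presburger
  thus "bipartite_permutation n p (2*i + 1) = 2*i + 1"
    by (rule permutes_not_in[OF perm])
qed

lemma bipartite_pair_edges:
  assumes p: "p permutes {0..<n}"
  shows "pair_matching n (bipartite_permutation n p) \<subseteq> complete_graph_edges (2*n)"
proof
  let ?q = "bipartite_permutation n p"
  fix e assume "e \<in> pair_matching n ?q"
  then obtain i where i: "i \<in> {1..n}" "e = {?q (2*i - 1), ?q (2*i)}"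
    by (auto simp: pair_matching_def)
  have "2*i - 1 \<in> {1..2*n}" "2*i \<in> {1..2*n}" "2*i - 1 \<noteq> 2*i" using i by auto
  hence "?q (2*i - 1) \<in> {1..2*n}" "?q (2*i) \<in> {1..2*n}" "?q (2*i - 1) \<noteq> ?q (2*i)"
    using permutes_in_image[OF bipartite_permutation(1)[OF p]]
      permutes_inj[OF bipartite_permutation(1)[OF p]] by (auto dest: injD)
  thus "e \<in> complete_graph_edges (2*n)"
    using i by (auto simp: complete_graph_edges_def nsets_def)
qed

lemma matching_sign_bipartite:
  assumes D: "orientation (complete_graph_edges (2*n)) D" and p: "p permutes {0..<n}"
  shows "matching_sign n D (pair_matching n (bipartite_permutation n p)) =
           sign p * (\<Prod>i=0..<n. if (2*i + 1, 2 * p i + 2) \<in> D then 1 else -1)"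
proof -
  let ?q = "bipartite_permutation n p"
  have "(\<Prod>i=1..n. if (?q (2*i - 1), ?q (2*i)) \<in> D then 1 else -1 :: int)
      = (\<Prod>i=0..<n. if (?q (2*i + 1), ?q (2*i + 2)) \<in> D then 1 else -1)"
    by (simp add: prod.atLeast1_atMost_eq atLeast0LessThan)
  also have "\<dots> = (\<Prod>i=0..<n. if (2*i + 1, 2 * p i + 2) \<in> D then 1 else -1)"
    using bipartite_permutation(3,4)[OF p] by (intro prod.cong) auto
  finally show ?thesis
    using matching_sign_pair_matching[OF _ D bipartite_permutation(1)[OF p] bipartite_pair_edges[OF p]]
    by (simp add: complete_graph_edges_def bipartite_permutation(2)[OF p])
qed

lemma fact_le_of_k_pfaffian_complete_graph:
  assumes "k_pfaffian n (complete_graph_edges (2*n)) k"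
  shows "fact n \<le> 2 ^ k * sqrt (real n ^ n)"
proof -
  let ?E = "complete_graph_edges (2*n)"
  obtain Ds x where or: "\<And>j. j \<in> {1..k} \<Longrightarrow> orientation ?E (Ds j)"
    and x: "\<And>M. perfect_matching n ?E M \<Longrightarrow> (\<Sum>j=1..k. signature_matrix n Ds M j * x j) = 1"
    using assms unfolding k_pfaffian_def pfaffian_k_orientation_def k_orientation_def by blast
  define b :: "nat \<Rightarrow> nat \<Rightarrow> nat \<Rightarrow> real"
    where "b = (\<lambda>j i l. if (2*i + 1, 2*l + 2) \<in> Ds j then 1 else -1)"
  \<comment> \<open>the equation of the row of \<open>p\<close>, multiplied by \<open>sign p\<close>\<close>
  have row: "(\<Sum>j=1..k. (\<Prod>i=0..<n. b j i (p i)) * x j) = of_int (sign p)"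
    if p: "p permutes {0..<n}" for p
  proof -
    define M where "M = pair_matching n (bipartite_permutation n p)"
    have "perfect_matching n ?E M"
      unfolding M_def
      by (rule perfect_matching_pair_matching[OF bipartite_permutation(1)[OF p] bipartite_pair_edges[OF p]])
    hence "1 = (\<Sum>j=1..k. signature_matrix n Ds M j * x j)" by (simp only: x)
    also have "\<dots> = (\<Sum>j=1..k. of_int (sign p) * ((\<Prod>i=0..<n. b j i (p i)) * x j))"
    proof (intro sum.cong refl)
      fix j assume j: "j \<in> {1..k}"
      have "signature_matrix n Ds M j = of_int (sign p) * (\<Prod>i=0..<n. b j i (p i))"
        unfolding signature_matrix_def M_def matching_sign_bipartite[OF or[OF j] p] b_def
        by (simp add: of_int_prod if_distrib cong: if_cong)
      thus "signature_matrix n Ds M j * x j = of_int (sign p) * ((\<Prod>i=0..<n. b j i (p i)) * x j)"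
        by simp
    qed
    also have "\<dots> = of_int (sign p) * (\<Sum>j=1..k. (\<Prod>i=0..<n. b j i (p i)) * x j)"
      by (simp add: sum_distrib_left)
    finally show ?thesis by (auto simp: sign_def split: if_splits)
  qed
  have "fact n \<le> 2 ^ card {1..k} * sqrt (real n ^ n)"
  proof (rule card_permutations_le_of_sign_determined)
    show "finite {1..k}" by simp
    show "\<bar>b j i l\<bar> = 1" for j i l by (simp add: b_def)
  next
    fix p q assume pq: "p permutes {0..<n}" "q permutes {0..<n}"
      and eq: "\<And>j. j \<in> {1..k} \<Longrightarrow> (\<Prod>i=0..<n. b j i (p i)) = (\<Prod>i=0..<n. b j i (q i))"
    have "real_of_int (sign p) = (\<Sum>j=1..k. (\<Prod>i=0..<n. b j i (p i)) * x j)"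
      by (simp only: row[OF pq(1)])
    also have "\<dots> = (\<Sum>j=1..k. (\<Prod>i=0..<n. b j i (q i)) * x j)"
      by (intro sum.cong refl) (simp only: eq)
    also have "\<dots> = real_of_int (sign q)" by (simp only: row[OF pq(2)])
    finally show "sign p = sign q" by simp
  qed
  thus ?thesis by simp
qed

theorem corollary14:
  shows "\<exists>c::real. c > 0 \<and> (\<exists>n0::nat. \<forall>n::nat. n \<ge> n0 \<longrightarrow>
           real (pfaffian_number n (complete_graph_edges (2 * n))) \<ge> c * real n * log 2 (real n))"
proof (intro exI[of _ "1/4"] conjI exI[of _ "nat \<lceil>exp 4 :: real\<rceil>"] allI impI)
  fix n :: nat assume "nat \<lceil>exp 4 :: real\<rceil> \<le> n"
  hence "exp 4 \<le> real n" by linarith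
  moreover have "k_pfaffian n (complete_graph_edges (2*n))
      (pfaffian_number n (complete_graph_edges (2*n)))"
    by (rule pfaffian_number_k_pfaffian) (simp add: complete_graph_edges_def)
  ultimately show "1/4 * real n * log 2 (real n)
      \<le> real (pfaffian_number n (complete_graph_edges (2 * n)))"
    using fact_le_of_k_pfaffian_complete_graph log_bound_of_fact_bound by blast
qed simp

end
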